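(* Let $r\geq 1$ and $n\geq 2r+15$ be integers, and let $G$ be a graph of order $n$ without isolated vertices such that $b(G)<\frac{1}{r}$. Then $$\rho(G)\leq \rho\big(K_1\vee(K_{n-r-2}\cup(r+1)K_1)\big),$$ with equality if and only if $G\cong K_1\vee\big(K_{n-r-2}\cup(r+1)K_1\big)$.
   Context: All graphs are finite and simple. $\rho(G)$ denotes the spectral radius (largest eigenvalue) of the adjacency matrix of $G$. For $S\subseteq V(G)$, $N_G(S)$ is the union of the neighborhoods of the vertices of $S$. The binding number of $G$ is $$b(G)=\min\Big\{\frac{|N_G(S)|}{|S|}:\emptyset\neq S\subseteq V(G),\ N_G(S)\neq V(G)\Big\}.$$ $G_1\cup G_2$ denotes the disjoint union, $G_1\vee G_2$ the join (disjoint union plus all edges between $V(G_1)$ and $V(G_2)$), $K_m$ the complete graph on $m$ vertices and $sK_1$ the edgeless graph on $s$ vertices. *)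

theory Defs
  imports
    "Graph_Theory.Pair_Digraph"
    "Graph_Theory.Digraph_Isomorphism"
    "Jordan_Normal_Form.Spectral_Radius"
begin

text \<open>
  A finite simple graph is a digraph satisfying \<open>pair_graph\<close>: finite, loop-free, without
  parallel arcs and with a symmetric arc relation, so that each edge \<open>uv\<close> is represented
  by the two arcs \<open>(u, v)\<close> and \<open>(v, u)\<close>.
\<close>

subsection \<open>Spectral radius\<close>

definition adjacency_mat :: "'a pair_pre_digraph \<Rightarrow> 'a list \<Rightarrow> complex mat" where
  "adjacency_mat G vs = mat (length vs) (length vs)
     (\<lambda>(i, j). if (vs ! i, vs ! j) \<in> parcs G then 1 else 0)"

text \<open>
  The vertices are enumerated in an arbitrary order; another order gives a similar matrix.
  The library's \<open>spectral_radius\<close> is the largest modulus of a complex eigenvalue. An adjacency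
  matrix is symmetric and nonnegative, so its eigenvalues are real and, by Perron-Frobenius,
  this number is its largest eigenvalue.
\<close>

definition graph_spectral_radius :: "'a pair_pre_digraph \<Rightarrow> real" where
  "graph_spectral_radius G =
     spectral_radius (adjacency_mat G (SOME vs. distinct vs \<and> set vs = pverts G))"

subsection \<open>Binding number\<close>

definition neighborhood :: "'a pair_pre_digraph \<Rightarrow> 'a set \<Rightarrow> 'a set" where
  "neighborhood G S = (\<Union>v\<in>S. {u. (v, u) \<in> parcs G})"

text \<open>
  If \<open>pverts G\<close> is finite and nonempty, the minimum is over a finite nonempty set:
  in a loop-free graph, \<open>neighborhood G {v}\<close> omits \<open>v\<close>.
\<close>

definition binding_number :: "'a pair_pre_digraph \<Rightarrow> real" where
  "binding_number G = Min {real (card (neighborhood G S)) / real (card S) | S.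
     S \<noteq> {} \<and> S \<subseteq> pverts G \<and> neighborhood G S \<noteq> pverts G}"

definition no_isolated_vertices :: "'a pair_pre_digraph \<Rightarrow> bool" where
  "no_isolated_vertices G \<longleftrightarrow> (\<forall>v\<in>pverts G. neighborhood G {v} \<noteq> {})"

subsection \<open>Constructions\<close>

definition complete_graph :: "nat \<Rightarrow> nat pair_pre_digraph" where
  "complete_graph m = \<lparr> pverts = {0..<m}, parcs = {(u, v). u < m \<and> v < m \<and> u \<noteq> v} \<rparr>"

definition edgeless_graph :: "nat \<Rightarrow> nat pair_pre_digraph" where
  "edgeless_graph s = \<lparr> pverts = {0..<s}, parcs = {} \<rparr>"

definition graph_union ::
    "'a pair_pre_digraph \<Rightarrow> 'b pair_pre_digraph \<Rightarrow> ('a + 'b) pair_pre_digraph" where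
  "graph_union G H = \<lparr> pverts = pverts G <+> pverts H,
     parcs = map_prod Inl Inl ` parcs G \<union> map_prod Inr Inr ` parcs H \<rparr>"

definition graph_join ::
    "'a pair_pre_digraph \<Rightarrow> 'b pair_pre_digraph \<Rightarrow> ('a + 'b) pair_pre_digraph" where
  "graph_join G H = \<lparr> pverts = pverts G <+> pverts H,
     parcs = parcs (graph_union G H)
       \<union> (Inl ` pverts G) \<times> (Inr ` pverts H) \<union> (Inr ` pverts H) \<times> (Inl ` pverts G) \<rparr>"

definition graph_iso :: "'a pair_pre_digraph \<Rightarrow> 'b pair_pre_digraph \<Rightarrow> bool" where
  "graph_iso G H \<longleftrightarrow> digraph_iso (with_proj G) (with_proj H)"

lemma pair_graphI:
  assumes "finite (pverts G)" "parcs G \<subseteq> pverts G \<times> pverts G" "sym (parcs G)" "irrefl (parcs G)"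
  shows "pair_graph G"
proof
  show "finite (parcs G)"
    using assms(1,2) by (meson finite_SigmaI finite_subset)
qed (use assms in \<open>auto simp: symmetric_def irrefl_def\<close>)

lemma pair_graph_complete_graph: "pair_graph (complete_graph m)"
  by (rule pair_graphI) (auto simp: complete_graph_def sym_def irrefl_def)

lemma pair_graph_edgeless_graph: "pair_graph (edgeless_graph s)"
  by (rule pair_graphI) (auto simp: edgeless_graph_def sym_def irrefl_def)

lemma pair_graph_graph_union:
  assumes "pair_graph G" "pair_graph H"
  shows "pair_graph (graph_union G H)"
proof -
  interpret G: pair_graph G by fact
  interpret H: pair_graph H by fact
  show ?thesis
    by (rule pair_graphI)
       (auto simp: graph_union_def sym_def irrefl_def
         dest: G.in_arcsD1 G.in_arcsD2 H.in_arcsD1 H.in_arcsD2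
           G.arcs_symmetric H.arcs_symmetric G.no_loops' H.no_loops')
qed

lemma pair_graph_graph_join:
  assumes "pair_graph G" "pair_graph H"
  shows "pair_graph (graph_join G H)"
proof -
  interpret G: pair_graph G by fact
  interpret H: pair_graph H by fact
  show ?thesis
    by (rule pair_graphI)
       (auto simp: graph_join_def graph_union_def sym_def irrefl_def
         dest: G.in_arcsD1 G.in_arcsD2 H.in_arcsD1 H.in_arcsD2
           G.arcs_symmetric H.arcs_symmetric G.no_loops' H.no_loops')
qed

end

theory Submission
  imports Defs
begin

text \<open>
  A set with small binding quotient yields an independent set \<open>S\<close> with \<open>r t + 1\<close> elements whose
  neighbours lie in a set \<open>T\<close> with \<open>t \<ge> 1\<close> elements, so \<open>G\<close> is a spanning subgraph of
  \<open>K\<^sub>t \<or> (K\<^sub>c \<union> (r t + 1) K\<^sub>1)\<close>, where \<open>c = n - t - (r t + 1)\<close>. If a positive weight \<open>x\<close> satisfies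
  \<open>A x \<le> \<mu> x\<close>, then \<open>\<rho>(G) \<le> \<mu>\<close>. Weights that are constant on \<open>T\<close>, \<open>S\<close> and the clique give
  \<open>\<rho>(G) \<le> n - r - 2\<close> for \<open>t \<ge> 2\<close>. For \<open>t = 1\<close> they give \<open>\<rho>(G) \<le> \<lambda>\<close>, where \<open>\<lambda> > n - r - 2\<close> is the
  spectral radius of the extremal graph; equality forces every vertex to have all the neighbours
  that it has in the extremal graph, because the vertices where \<open>|f| / x\<close> is maximal for an
  eigenfunction \<open>f\<close> are closed under adjacency.
\<close>

section \<open>Eigenvalues as functions on the vertices\<close>

lemma neighborhood_eq_Image: "neighborhood G S = parcs G `` S"
  by (auto simp: neighborhood_def)

text \<open>Removes the enumeration \<open>vs\<close>: reading entry \<open>j\<close> of a vector as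
  the value at \<open>vs ! j\<close> turns a matrix row into a sum over a neighbourhood.\<close>

lemma eigenvalue_adjacency_mat_iff:
  assumes G: "pair_graph G" and vs: "distinct vs" "set vs = pverts G"
  shows "eigenvalue (adjacency_mat G vs) k \<longleftrightarrow>
    (\<exists>f. (\<exists>v\<in>pverts G. f v \<noteq> 0) \<and> (\<forall>v\<in>pverts G. (\<Sum>u\<in>parcs G `` {v}. f u) = k * f v))"
    (is "_ \<longleftrightarrow> (\<exists>f. ?P f)")
proof -
  interpret pair_graph G by fact
  let ?n = "length vs" and ?A = "adjacency_mat G vs"
  have dim: "dim_row ?A = ?n" "dim_col ?A = ?n"
    by (simp_all add: adjacency_mat_def)
  have mult: "(?A *\<^sub>v w) $ i = (\<Sum>u\<in>parcs G `` {vs ! i}. f u)"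
    if w: "w \<in> carrier_vec ?n" "\<And>j. j < ?n \<Longrightarrow> w $ j = f (vs ! j)" and i: "i < ?n" for w f i
  proof -
    have "(?A *\<^sub>v w) $ i = (\<Sum>j<?n. (if (vs ! i, vs ! j) \<in> parcs G then f (vs ! j) else 0))"
      using i w by (auto simp: adjacency_mat_def scalar_prod_def atLeast0LessThan intro!: sum.cong)
    also have "\<dots> = (\<Sum>u\<in>pverts G. if (vs ! i, u) \<in> parcs G then f u else 0)"
      using bij_betw_nth[OF vs(1) refl vs(2)[symmetric]]
      by (rule sum.reindex_bij_betw)
    also have "\<dots> = (\<Sum>u\<in>parcs G `` {vs ! i}. f u)"
      by (subst sum.inter_filter[symmetric]) (auto intro!: sum.cong dest: in_arcsD2)
    finally show ?thesis .
  qed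
  have vec: "?A *\<^sub>v w = k \<cdot>\<^sub>v w \<longleftrightarrow> (\<forall>v\<in>pverts G. (\<Sum>u\<in>parcs G `` {v}. f u) = k * f v)"
    if w: "w \<in> carrier_vec ?n" "\<And>j. j < ?n \<Longrightarrow> w $ j = f (vs ! j)" for w f
  proof -
    have "?A *\<^sub>v w = k \<cdot>\<^sub>v w \<longleftrightarrow> (\<forall>i<?n. (?A *\<^sub>v w) $ i = k * w $ i)"
      using w(1) dim by (auto simp: vec_eq_iff)
    also have "\<dots> \<longleftrightarrow> (\<forall>i<?n. (\<Sum>u\<in>parcs G `` {vs ! i}. f u) = k * f (vs ! i))"
      using mult[OF w] w(2) by auto
    finally show ?thesis
      by (simp add: vs(2)[symmetric] all_set_conv_all_nth)
  qed
  show ?thesis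
  proof
    assume "eigenvalue ?A k"
    then obtain w where w: "w \<in> carrier_vec ?n" "w \<noteq> 0\<^sub>v ?n" "?A *\<^sub>v w = k \<cdot>\<^sub>v w"
      by (auto simp: eigenvalue_def eigenvector_def dim)
    define f where "f v = w $ (the_inv_into {..<?n} ((!) vs) v)" for v
    have f: "w $ j = f (vs ! j)" if "j < ?n" for j
      using that bij_betw_nth[OF vs(1) refl refl]
      by (simp add: f_def bij_betw_def the_inv_into_f_f)
    obtain i where "i < ?n" "w $ i \<noteq> 0"
      using w(1,2) by (auto simp: vec_eq_iff)
    then have "vs ! i \<in> pverts G" "f (vs ! i) \<noteq> 0"
      using vs(2) f by auto
    then show "\<exists>f. ?P f"
      using vec[OF w(1) f] w(3) by blast
  next
    assume "\<exists>f. ?P f"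
    then obtain f where f: "?P f" ..
    define w where "w = Matrix.vec ?n (\<lambda>j. f (vs ! j))"
    have w: "w \<in> carrier_vec ?n" "\<And>j. j < ?n \<Longrightarrow> w $ j = f (vs ! j)"
      by (auto simp: w_def)
    moreover have "w \<noteq> 0\<^sub>v ?n"
    proof
      assume "w = 0\<^sub>v ?n"
      then have "\<forall>i<?n. f (vs ! i) = 0"
        using w(2) by auto
      with f show False
        by (auto simp: vs(2)[symmetric] in_set_conv_nth)
    qed
    ultimately show "eigenvalue ?A k"
      using vec[OF w] f by (auto simp: eigenvalue_def eigenvector_def dim)
  qed
qed

text \<open>The interface to \<open>graph_spectral_radius\<close>: its value is attained as the
  modulus of an eigenvalue, and it bounds every such modulus. Eigenfunctions are complex because the
  radius is a largest modulus over the complex spectrum.\<close>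

lemma
  fixes f :: "'a \<Rightarrow> complex"
  assumes G: "pair_graph G" and ne: "pverts G \<noteq> {}"
  shows graph_spectral_radius_eigenfunction:
      "\<exists>(k::complex) f. norm k = graph_spectral_radius G \<and> (\<exists>v\<in>pverts G. f v \<noteq> 0) \<and>
        (\<forall>v\<in>pverts G. (\<Sum>u\<in>parcs G `` {v}. f u) = k * f v)"
    and norm_le_graph_spectral_radius:
      "v \<in> pverts G \<Longrightarrow> f v \<noteq> 0 \<Longrightarrow> (\<And>v. v \<in> pverts G \<Longrightarrow> (\<Sum>u\<in>parcs G `` {v}. f u) = k * f v)
        \<Longrightarrow> norm k \<le> graph_spectral_radius G"
proof -
  interpret pair_graph G by fact
  define vs where "vs = (SOME vs. distinct vs \<and> set vs = pverts G)"
  have vs: "distinct vs" "set vs = pverts G"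
  proof -
    have "\<exists>vs. distinct vs \<and> set vs = pverts G"
      using finite_distinct_list[OF finite_verts] by blast
    from someI_ex[OF this] show "distinct vs" "set vs = pverts G"
      by (simp_all add: vs_def)
  qed
  have rho: "graph_spectral_radius G = spectral_radius (adjacency_mat G vs)"
    by (simp add: graph_spectral_radius_def vs_def)
  have A: "adjacency_mat G vs \<in> carrier_mat (length vs) (length vs)" and "0 < length vs"
    using vs(2) ne by (auto simp: adjacency_mat_def)
  note max = spectral_radius_mem_max[OF this, folded rho]
  note eig = eigenvalue_adjacency_mat_iff[OF G vs]
  obtain k\<^sub>0 where "eigenvalue (adjacency_mat G vs) k\<^sub>0" "norm k\<^sub>0 = graph_spectral_radius G"
    using max(1) by (auto simp: spectrum_def)
  then show "\<exists>(k::complex) f. norm k = graph_spectral_radius G \<and> (\<exists>v\<in>pverts G. f v \<noteq> 0) \<and>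
      (\<forall>v\<in>pverts G. (\<Sum>u\<in>parcs G `` {v}. f u) = k * f v)"
    unfolding eig by blast
  assume "v \<in> pverts G" "f v \<noteq> 0" "\<And>v. v \<in> pverts G \<Longrightarrow> (\<Sum>u\<in>parcs G `` {v}. f u) = k * f v"
  then have "eigenvalue (adjacency_mat G vs) k"
    unfolding eig by blast
  then show "norm k \<le> graph_spectral_radius G"
    using max(2) by (auto simp: spectrum_def)
qed

section \<open>Bounding the spectral radius by a positive weight\<close>

text \<open>Let \<open>c\<close> be the maximum of |f| / x for an eigenfunction \<open>f\<close> of
  modulus \<open>graph_spectral_radius G\<close>. At a vertex \<open>v\<close> attaining it, the
  triangle inequality and the hypothesis on \<open>x\<close> give rho * c * x v \<le> \<mu> * c * x
  v. If rho = \<mu>, every inequality in between is tight, so the neighbours of \<open>v\<close>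
  attain the maximum too.\<close>

lemma
  fixes x :: "'a \<Rightarrow> real"
  assumes G: "pair_graph G" and ne: "pverts G \<noteq> {}"
    and pos: "\<And>v. v \<in> pverts G \<Longrightarrow> 0 < x v"
    and sub: "\<And>v. v \<in> pverts G \<Longrightarrow> (\<Sum>u\<in>parcs G `` {v}. x u) \<le> \<mu> * x v"
  shows graph_spectral_radius_le: "graph_spectral_radius G \<le> \<mu>"
    and graph_spectral_radius_eqD: "graph_spectral_radius G = \<mu> \<Longrightarrow>
      \<exists>M. M \<noteq> {} \<and> M \<subseteq> pverts G \<and>
        (\<forall>v\<in>M. parcs G `` {v} \<subseteq> M \<and> (\<Sum>u\<in>parcs G `` {v}. x u) = \<mu> * x v)"
proof -
  interpret pair_graph G by fact
  obtain k :: complex and f where k: "norm k = graph_spectral_radius G" and f0: "\<exists>v\<in>pverts G. f v \<noteq> 0"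
    and f: "\<And>v. v \<in> pverts G \<Longrightarrow> (\<Sum>u\<in>parcs G `` {v}. f u) = k * f v"
    using graph_spectral_radius_eigenfunction[OF G ne] by blast
  define c where "c = Max ((\<lambda>v. norm (f v) / x v) ` pverts G)"
  have c_ge: "norm (f v) \<le> c * x v" if "v \<in> pverts G" for v
  proof -
    have "norm (f v) / x v \<le> c"
      unfolding c_def using that by (intro Max_ge) auto
    then show ?thesis
      using pos[OF that] by (simp add: field_simps)
  qed
  obtain v0 where v0: "v0 \<in> pverts G" "f v0 \<noteq> 0"
    using f0 by blast
  have c: "0 < c"
    using c_ge[OF v0(1)] v0 pos[OF v0(1)]
    by (metis zero_less_norm_iff less_le_trans zero_less_mult_pos2)
  define M where "M = {v \<in> pverts G. norm (f v) = c * x v}"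
  have "c \<in> (\<lambda>v. norm (f v) / x v) ` pverts G"
    unfolding c_def using ne by (intro Max_in) auto
  then have M: "M \<noteq> {}"
    using pos by (fastforce simp: M_def)
  have nb: "parcs G `` {v} \<subseteq> pverts G" "finite (parcs G `` {v})" for v
    using finite_subset[OF _ finite_verts] by (auto dest: in_arcsD2)
  have chain: "graph_spectral_radius G * (c * x v) \<le> (\<Sum>u\<in>parcs G `` {v}. norm (f u))"
    "(\<Sum>u\<in>parcs G `` {v}. norm (f u)) \<le> c * (\<Sum>u\<in>parcs G `` {v}. x u)"
    "c * (\<Sum>u\<in>parcs G `` {v}. x u) \<le> \<mu> * (c * x v)" if "v \<in> M" for v
  proof -
    have v: "v \<in> pverts G" "norm (f v) = c * x v"
      using that by (auto simp: M_def)
    have "graph_spectral_radius G * (c * x v) = norm (\<Sum>u\<in>parcs G `` {v}. f u)"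
      unfolding f[OF v(1)] norm_mult k v(2) ..
    also have "\<dots> \<le> (\<Sum>u\<in>parcs G `` {v}. norm (f u))"
      by (rule norm_sum)
    finally show "graph_spectral_radius G * (c * x v) \<le> (\<Sum>u\<in>parcs G `` {v}. norm (f u))" .
    show "(\<Sum>u\<in>parcs G `` {v}. norm (f u)) \<le> c * (\<Sum>u\<in>parcs G `` {v}. x u)"
      unfolding sum_distrib_left using nb(1) c_ge by (intro sum_mono) blast
    show "c * (\<Sum>u\<in>parcs G `` {v}. x u) \<le> \<mu> * (c * x v)"
      using mult_left_mono[OF sub[OF v(1)], of c] c by (simp add: mult.left_commute)
  qed
  obtain v where v: "v \<in> M"
    using M by blast
  then have "0 < c * x v"
    using pos c by (auto simp: M_def)
  moreover have "graph_spectral_radius G * (c * x v) \<le> \<mu> * (c * x v)"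
    using chain[OF v] by linarith
  ultimately show "graph_spectral_radius G \<le> \<mu>"
    by (metis mult_le_cancel_right_pos)
  assume eq: "graph_spectral_radius G = \<mu>"
  have "parcs G `` {v} \<subseteq> M \<and> (\<Sum>u\<in>parcs G `` {v}. x u) = \<mu> * x v" if v: "v \<in> M" for v
  proof
    \<comment> \<open>The two ends of \<open>chain\<close> now coincide, so these nonnegative
      differences sum to zero and each of them vanishes.\<close>
    have "(\<Sum>u\<in>parcs G `` {v}. c * x u - norm (f u)) = 0"
      unfolding sum_subtractf sum_distrib_left[symmetric] using chain[OF v, unfolded eq] by linarith
    moreover have "0 \<le> c * x u - norm (f u)" if "u \<in> parcs G `` {v}" for u
      using c_ge nb(1)[of v] that by (simp add: subset_iff)
    ultimately have "\<forall>u\<in>parcs G `` {v}. c * x u - norm (f u) = 0"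
      by (subst sum_nonneg_eq_0_iff[OF nb(2), symmetric])
    then show "parcs G `` {v} \<subseteq> M"
      using nb(1)[of v] by (auto simp: M_def)
    have "c * (\<Sum>u\<in>parcs G `` {v}. x u) = c * (\<mu> * x v)"
      using chain[OF v, unfolded eq] by (simp only: mult.left_commute[of c \<mu>])
    then show "(\<Sum>u\<in>parcs G `` {v}. x u) = \<mu> * x v"
      using c by simp
  qed
  then show "\<exists>M. M \<noteq> {} \<and> M \<subseteq> pverts G \<and>
      (\<forall>v\<in>M. parcs G `` {v} \<subseteq> M \<and> (\<Sum>u\<in>parcs G `` {v}. x u) = \<mu> * x v)"
    using M by (intro exI[of _ M]) (auto simp: M_def)
qed

text \<open>The weight serves twice: as a bound from above by the previous lemma, and, read as a
  complex eigenfunction, as a witness that \<mu> is an eigenvalue.\<close>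

lemma graph_spectral_radius_eqI:
  fixes x :: "'a \<Rightarrow> real"
  assumes G: "pair_graph G" and ne: "pverts G \<noteq> {}"
    and pos: "\<And>v. v \<in> pverts G \<Longrightarrow> 0 < x v"
    and eq: "\<And>v. v \<in> pverts G \<Longrightarrow> (\<Sum>u\<in>parcs G `` {v}. x u) = \<mu> * x v"
  shows "graph_spectral_radius G = \<mu>"
proof (rule antisym)
  show "graph_spectral_radius G \<le> \<mu>"
    using graph_spectral_radius_le[OF G ne pos] eq by simp
  obtain v where v: "v \<in> pverts G"
    using ne by blast
  have "norm (complex_of_real \<mu>) \<le> graph_spectral_radius G"
    by (rule norm_le_graph_spectral_radius[OF G ne v, of "\<lambda>v. of_real (x v)"])
      (use pos[OF v] eq in \<open>simp_all flip: of_real_sum of_real_mult\<close>)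
  then show "\<mu> \<le> graph_spectral_radius G"
    by simp
qed

section \<open>Isomorphisms as vertex bijections\<close>

text \<open>Arcs are pairs of vertices, so the arc map of an isomorphism is forced to be
  \<open>map_prod h h\<close>, and respecting arcs amounts to mapping neighbourhoods onto
  neighbourhoods.\<close>

lemma graph_iso_iff:
  assumes G: "pair_graph G" and H: "pair_graph H"
  shows "graph_iso G H \<longleftrightarrow> (\<exists>h. bij_betw h (pverts G) (pverts H) \<and>
    (\<forall>v\<in>pverts G. parcs H `` {h v} = h ` (parcs G `` {v})))"
    (is "_ \<longleftrightarrow> (\<exists>h. ?P h)")
proof
  interpret G: pair_graph G by fact
  interpret H: pair_graph H by fact
  assume "graph_iso G H"
  then obtain F where F: "pre_digraph.digraph_isomorphism (with_proj G) F"
      "with_proj H = app_iso F (with_proj G)"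
    by (auto simp: graph_iso_def digraph_iso_def)
  define h where "h = iso_verts F"
  have verts: "pverts H = h ` pverts G" and arcs: "parcs H = iso_arcs F ` parcs G"
    and "iso_tail F = fst" "iso_head F = snd"
    using arg_cong[OF F(2), of verts] arg_cong[OF F(2), of arcs]
      arg_cong[OF F(2), of tail] arg_cong[OF F(2), of head] by (simp_all add: h_def)
  then have inj: "inj_on h (pverts G)" and "\<forall>a\<in>parcs G. iso_arcs F a = map_prod h h a"
    using F(1) by (auto simp: pre_digraph.digraph_isomorphism_def h_def prod_eq_iff)
  then have arcs_eq: "parcs H = map_prod h h ` parcs G"
    unfolding arcs by (intro image_cong) auto
  have "parcs H `` {h v} = h ` (parcs G `` {v})" if "v \<in> pverts G" for v
  proof (intro Set.set_eqI iffI)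
    fix w assume "w \<in> parcs H `` {h v}"
    then obtain u u' where u: "(u, u') \<in> parcs G" "h u = h v" "h u' = w"
      using arcs_eq by auto
    then have "u = v"
      using inj_onD[OF inj] that G.in_arcsD1 by blast
    with u show "w \<in> h ` (parcs G `` {v})"
      by blast
  next
    fix w assume "w \<in> h ` (parcs G `` {v})"
    then show "w \<in> parcs H `` {h v}"
      using arcs_eq by auto
  qed
  then show "\<exists>h. ?P h"
    using inj verts by (auto simp: bij_betw_def)
next
  interpret G: pair_graph G by fact
  interpret H: pair_graph H by fact
  assume "\<exists>h. ?P h"
  then obtain h where inj: "inj_on h (pverts G)" and verts: "pverts H = h ` pverts G"
    and nb: "\<And>v. v \<in> pverts G \<Longrightarrow> parcs H `` {h v} = h ` (parcs G `` {v})"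
    by (auto simp: bij_betw_def)
  define F where "F = \<lparr>iso_verts = h, iso_arcs = map_prod h h, iso_head = snd, iso_tail = fst\<rparr>"
  have "inj_on (map_prod h h) (parcs G)"
    by (rule inj_on_subset[OF map_prod_inj_on[OF inj inj]])
      (auto dest: G.in_arcsD1 G.in_arcsD2)
  then have "pre_digraph.digraph_isomorphism (with_proj G) F"
    using inj G.wf_digraph by (auto simp: pre_digraph.digraph_isomorphism_def F_def)
  moreover have "parcs H = map_prod h h ` parcs G"
  proof (intro Set.set_eqI iffI)
    fix a assume "a \<in> parcs H"
    moreover obtain p w where "a = (p, w)"
      by (cases a)
    moreover have "p \<in> h ` pverts G"
      using H.in_arcsD1 calculation verts by simp
    ultimately obtain v where a: "a = (h v, w)" "v \<in> pverts G" "w \<in> parcs H `` {h v}"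
      by blast
    then obtain u where "w = h u" "(v, u) \<in> parcs G"
      using nb by blast
    then show "a \<in> map_prod h h ` parcs G"
      using a(1) by (intro image_eqI[of _ _ "(v, u)"]) auto
  next
    fix a assume "a \<in> map_prod h h ` parcs G"
    then obtain u v where "a = (h u, h v)" "(u, v) \<in> parcs G"
      by auto
    then show "a \<in> parcs H"
      using nb[of u] by (auto dest: G.in_arcsD1)
  qed
  then have "with_proj H = app_iso F (with_proj G)"
    using verts by (simp add: app_iso_def F_def with_proj_def)
  ultimately show "graph_iso G H"
    by (auto simp: graph_iso_def digraph_iso_def)
qed

section \<open>The join as a hull on three parts\<close>

text \<open>
  The neighbourhood of \<open>v\<close> in \<open>K\<^sub>t \<or> (K\<^sub>c \<union> s K\<^sub>1)\<close>, with the three parts on \<open>T\<close>, \<open>C\<close> and \<open>S\<close>.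
\<close>

definition hull_nbrs :: "'a set \<Rightarrow> 'a set \<Rightarrow> 'a set \<Rightarrow> 'a \<Rightarrow> 'a set" where
  "hull_nbrs T S C v = (if v \<in> S then T else if v \<in> T then (T \<union> S \<union> C) - {v} else (T \<union> C) - {v})"

text \<open>These are the rows of the quotient matrix: in the hull, the number of neighbours in each
  part depends only on the part of \<open>v\<close>.\<close>

lemma sum_hull_nbrs:
  fixes a b c :: real
  assumes fin: "finite T" "finite S" "finite C"
    and disj: "T \<inter> S = {}" "T \<inter> C = {}" "S \<inter> C = {}"
    and v: "v \<in> T \<union> S \<union> C"
  defines "x \<equiv> \<lambda>v. if v \<in> T then a else if v \<in> S then b else c"
  shows "sum x (hull_nbrs T S C v) =
    (if v \<in> T then (real (card T) - 1) * a + card S * b + card C * c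
     else if v \<in> S then card T * a else card T * a + (real (card C) - 1) * c)"
proof -
  have x: "sum x T = card T * a" "sum x S = card S * b" "sum x C = card C * c"
  proof -
    have "sum x T = (\<Sum>_\<in>T. a)"
      by (rule sum.cong) (auto simp: x_def)
    moreover have "sum x S = (\<Sum>_\<in>S. b)"
      by (rule sum.cong) (use disj in \<open>auto simp: x_def\<close>)
    moreover have "sum x C = (\<Sum>_\<in>C. c)"
      by (rule sum.cong) (use disj in \<open>auto simp: x_def\<close>)
    ultimately show "sum x T = card T * a" "sum x S = card S * b" "sum x C = card C * c"
      by simp_all
  qed
  have TC: "sum x (T \<union> C) = card T * a + card C * c"
    using fin disj by (simp add: sum.union_disjoint x)
  have "sum x (T \<union> S \<union> C) = card T * a + card S * b + card C * c"
    using fin disj by (simp add: sum.union_disjoint x Int_Un_distrib2)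
  moreover have "sum x (A - {v}) = sum x A - x v" if "v \<in> A" "finite A" for A
    using that by (simp add: sum_diff1)
  ultimately have diff: "sum x (T \<union> S \<union> C - {v}) = card T * a + card S * b + card C * c - x v"
    "v \<in> T \<union> C \<Longrightarrow> sum x (T \<union> C - {v}) = card T * a + card C * c - x v"
    using v fin TC by simp_all
  consider "v \<in> T" "v \<notin> S" | "v \<in> S" "v \<notin> T" | "v \<in> C" "v \<notin> S" "v \<notin> T"
    using v disj by blast
  then show ?thesis
    using diff x(1) by cases (simp_all add: hull_nbrs_def x_def algebra_simps)
qed

lemma image_hull_nbrs:
  assumes inj: "inj_on h (T \<union> S \<union> C)" and v: "v \<in> T \<union> S \<union> C"
  shows "h ` hull_nbrs T S C v = hull_nbrs (h ` T) (h ` S) (h ` C) (h v)"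
proof -
  have mem: "h v \<in> h ` A \<longleftrightarrow> v \<in> A" and diff: "h ` (A - {v}) = h ` A - {h v}"
    if "A \<subseteq> T \<union> S \<union> C" for A
  proof -
    show "h v \<in> h ` A \<longleftrightarrow> v \<in> A"
      by (rule inj_on_image_mem_iff[OF inj v that])
    have "h ` (A - {v}) = h ` A - h ` {v}"
      by (rule inj_on_image_set_diff[OF inj]) (use that v in blast)+
    then show "h ` (A - {v}) = h ` A - {h v}"
      by simp
  qed
  have "h v \<in> h ` S \<longleftrightarrow> v \<in> S" "h v \<in> h ` T \<longleftrightarrow> v \<in> T"
    by (rule mem; blast)+
  moreover have "h ` (T \<union> S \<union> C - {v}) = h ` T \<union> h ` S \<union> h ` C - {h v}"
    "h ` (T \<union> C - {v}) = h ` T \<union> h ` C - {h v}"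
    using diff[of "T \<union> S \<union> C"] diff[of "T \<union> C"] by (simp_all add: image_Un Un_upper1 Un_upper2 le_supI1)
  ultimately show ?thesis
    by (simp add: hull_nbrs_def)
qed

section \<open>Real inequalities for the quotient matrices\<close>

text \<open>
  \<open>m / (l - m + 1) + s / l = l\<close> is the eigenvalue equation at the centre of \<open>K\<^sub>1 \<or> (K\<^sub>m \<union> s K\<^sub>1)\<close>
  for the weights \<open>1\<close>, \<open>1 / (l - m + 1)\<close> and \<open>1 / l\<close>, for which it holds at the other vertices.
\<close>

lemma extremal_eigenvalue_exists:
  fixes m s :: real
  assumes "0 < m" "1 \<le> s"
  obtains l where "m < l" "m / (l - m + 1) + s / l = l"
proof -
  \<comment> \<open>The intermediate value theorem is applied on [m, m + s]. At m the value is - s /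
    m, which is negative, so the root differs from m.\<close>
  let ?g = "\<lambda>l. l - (m / (l - m + 1) + s / l)"
  have "?g m \<le> 0"
    using assms by simp
  moreover have "0 \<le> ?g (m + s)"
  proof -
    have "m / (s + 1) \<le> m" "s / (m + s) \<le> 1"
      using assms by (simp_all add: divide_simps)
    moreover have "1 \<le> s" by fact
    ultimately show ?thesis
      unfolding add_diff_cancel_left' by linarith
  qed
  moreover have "continuous_on {m..m + s} ?g"
    using assms by (intro continuous_intros) auto
  ultimately obtain l where "m \<le> l" "?g l = 0"
    using IVT'[of ?g m 0 "m + s"] assms by auto
  moreover have "l \<noteq> m"
    using assms \<open>?g l = 0\<close> by auto
  ultimately show ?thesis
    using that[of l] by simp
qed

text \<open>
  The inequality \<open>A x \<le> l x\<close> on the \<open>t\<close> dominating vertices, where \<open>x\<close> is \<open>1\<close> on these, \<open>t / l\<close> on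
  the independent set and \<open>t / q\<close> on the clique, which has \<open>l + 1 - q\<close> vertices.
\<close>

lemma quotient_row_bound:
  fixes r t n :: nat
  assumes r: "1 \<le> r" and t: "2 \<le> t" and n1: "2 * r + 15 \<le> n" and n2: "(r + 1) * t + 1 \<le> n"
  defines "l \<equiv> real n - real r - 2" and "q \<equiv> (real r + 1) * (real t - 1) + 1"
  shows "real t - 1 + (real r * real t + 1) * (real t / l) + (l + 1 - q) * (real t / q) \<le> l"
proof -
  define R T where "R = real r" and "T = real t"
  have R: "1 \<le> R" and T: "2 \<le> T" using r t by (simp_all add: R_def T_def)
  have l1: "R + 13 \<le> l" using n1 by (simp add: l_def R_def)
  have l2: "q \<le> l + 1"
  proof -
    have "(R + 1) * T + 1 \<le> real n"
      unfolding R_def T_def using n2 by (simp flip: of_nat_mult of_nat_Suc add: add.commute)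
    then show ?thesis by (simp add: q_def l_def R_def T_def algebra_simps)
  qed
  have q: "q = (R + 1) * (T - 1) + 1" by (simp add: q_def R_def T_def)
  have qpos: "0 < q" using R T by (simp add: q add_nonneg_pos)
  have lpos: "0 < l" using l1 R by simp
  \<comment> \<open>This is the claim multiplied by \<open>q * l\<close>, simplified with q - T = R
    * (T - 1).\<close>
  have key: "q * (T * (R * T + 1)) \<le> R * (T - 1) * (l * (l + 1))"
  \<comment> \<open>For large t, the bound (R + 1) * (T - 1) \<le> l from \<open>l2\<close>
    suffices. For small t it can be too weak (r = 1, t = 4 gives 20 against 18), and l \<ge> R + 13
    from \<open>n1\<close> takes over.\<close>
  proof (cases "5 \<le> t")
    case True
    then have T5: "5 \<le> T" by (simp add: T_def)
    have "T * (R * T + 1) \<le> R * (T - 1) * ((R + 1) * (T - 1))"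
    proof -
      have "0 \<le> (R - 1) * (R * (T - 1)\<^sup>2)" using R by simp
      moreover define P where "P = (T - 5) * (T + 1) + 7"
      have "P = T + (T * (T - 5) + 2)" "0 \<le> T * (T - 5)"
        using T5 by (simp_all add: P_def algebra_simps)
      then have "T \<le> P"
        by linarith
      moreover have "1 * P \<le> R * P"
        using R T5 by (intro mult_right_mono) (auto simp: P_def)
      ultimately have "0 \<le> (R - 1) * (R * (T - 1)\<^sup>2) + (R * P - T)"
        by linarith
      then show ?thesis by (simp add: P_def algebra_simps power2_eq_square)
    qed
    also have "\<dots> \<le> R * (T - 1) * l"
      using R T l2 by (intro mult_left_mono) (auto simp: q)
    finally have l: "T * (R * T + 1) \<le> R * (T - 1) * l" .
    have "q * (T * (R * T + 1)) \<le> (l + 1) * (R * (T - 1) * l)"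
      by (rule mult_mono[OF l2 l]) (use R T lpos in auto)
    then show ?thesis by (simp add: algebra_simps)
  next
    case False
    with t have t': "t = 2 \<or> t = 3 \<or> t = 4" by auto
    have "(R + 13) * (R + 14) \<le> l * (l + 1)"
      by (rule mult_mono) (use l1 R in auto)
    then have "R * (T - 1) * ((R + 13) * (R + 14)) \<le> R * (T - 1) * (l * (l + 1))"
      using R T by (intro mult_left_mono) auto
    moreover have "q * (T * (R * T + 1)) \<le> R * (T - 1) * ((R + 13) * (R + 14))"
    proof -
      \<comment> \<open>With these two facts the cubic inequality in R becomes linear in the
        monomials, for each of the three values of T.\<close>
      have "0 \<le> (R - 1)^3" "0 \<le> (R - 1)^2" using R by auto
      then show ?thesis
        using t' R by (auto simp: q T_def algebra_simps power2_eq_square power3_eq_cube)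
    qed
    ultimately show ?thesis by linarith
  qed
  have "T - 1 + (R * T + 1) * (T / l) + (l + 1 - q) * (T / q) - l
      = (q * (T * (R * T + 1)) - R * (T - 1) * (l * (l + 1))) / (q * l)"
  proof -
    have "T * (l + 1) * l - (l + 1) * (q * l) = - (R * (T - 1) * (l * (l + 1)))"
      by (simp add: q algebra_simps)
    then show ?thesis
      using qpos lpos by (simp add: field_simps)
  qed
  also have "\<dots> \<le> 0"
    using key qpos lpos by (intro divide_nonpos_pos) auto
  finally show ?thesis
    by (simp add: R_def T_def)
qed

section \<open>From the binding number to an independent set\<close>

lemma binding_number_lessD:
  fixes c :: real
  assumes G: "pair_graph G" and ne: "pverts G \<noteq> {}" and bn: "binding_number G < c"
  obtains S where "S \<noteq> {}" "S \<subseteq> pverts G" "parcs G `` S \<noteq> pverts G"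
    "card (parcs G `` S) < c * card S"
proof -
  interpret pair_graph G by fact
  let ?Q = "\<lambda>S. S \<noteq> {} \<and> S \<subseteq> pverts G \<and> neighborhood G S \<noteq> pverts G"
  let ?B = "{real (card (neighborhood G S)) / real (card S) | S. ?Q S}"
  obtain v where v: "v \<in> pverts G"
    using ne by blast
  \<comment> \<open>\<open>Min\<close> is meaningful only on a finite nonempty set; loop-freeness
    makes singletons admissible.\<close>
  have "?Q {v}"
    using v no_loops' by (auto simp: neighborhood_def)
  then have "?B \<noteq> {}"
    by blast
  moreover have "finite ?B"
    by (rule finite_subset[of _ "(\<lambda>S. real (card (neighborhood G S)) / real (card S)) ` Pow (pverts G)"])
      auto
  ultimately have "binding_number G \<in> ?B"
    unfolding binding_number_def by (rule Min_in[rotated])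
  then obtain S where S: "?Q S" "binding_number G = card (neighborhood G S) / card S"
    by blast
  have "0 < card S"
    using S(1) finite_subset[OF _ finite_verts] by (auto simp: card_gt_0_iff)
  then have "card (parcs G `` S) < c * card S"
    using bn S(2) by (simp add: neighborhood_eq_Image field_simps)
  then show ?thesis
    using that[of S] S(1) by (simp add: neighborhood_eq_Image)
qed

text \<open>
  Discarding from a set witnessing the small binding number the vertices that have a neighbour
  inside the set leaves an independent witness, since every discarded vertex lies in the
  neighbourhood of the set.
\<close>

lemma independent_witness:
  fixes r :: nat
  assumes G: "pair_graph G" and iso: "no_isolated_vertices G" and r: "1 \<le> r"
    and S: "S \<noteq> {}" "S \<subseteq> pverts G" and less: "r * card (parcs G `` S) < card S"
  obtains S' T where "S' \<subseteq> pverts G" "T \<subseteq> pverts G" "S' \<inter> T = {}" "parcs G `` S' \<subseteq> T"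
    "1 \<le> card T" "card S' = r * card T + 1"
proof -
  interpret pair_graph G by fact
  define S0 where "S0 = S - parcs G `` S"
  have fin: "finite S" "finite (parcs G `` A)" for A
    using finite_subset[OF _ finite_verts] S(2) by (auto dest: in_arcsD2)
  \<comment> \<open>A neighbour in \<open>S\<close> of a vertex \<open>u\<close> of
    \<open>S0\<close> would, by symmetry, put \<open>u\<close> into the neighbourhood of
    \<open>S\<close>.\<close>
  have "parcs G `` S0 \<inter> S = {}"
    by (auto simp: S0_def dest: arcs_symmetric)
  \<comment> \<open>The two sets are disjoint parts of the neighbourhood of \<open>S\<close>.
    Passing to \<open>S0\<close> thus costs the neighbourhood at least as many vertices as it costs
    \<open>S\<close>, and since r \<ge> 1 the strict inequality survives.\<close>
  then have "card (parcs G `` S0) + card (S \<inter> parcs G `` S) = card (parcs G `` S0 \<union> S \<inter> parcs G `` S)"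
    using fin by (subst card_Un_disjoint) auto
  also have "\<dots> \<le> card (parcs G `` S)"
    using fin by (intro card_mono) (auto simp: S0_def)
  finally have "r * card (parcs G `` S0) + r * card (S \<inter> parcs G `` S) < card S"
    using less by (metis add_mult_distrib2 le_less_trans mult_le_mono2)
  moreover have "card S = card S0 + card (S \<inter> parcs G `` S)"
    using fin card_Diff_subset_Int[of S "parcs G `` S"] card_mono[of S "S \<inter> parcs G `` S"] by (simp add: S0_def)
  moreover have "1 * card (S \<inter> parcs G `` S) \<le> r * card (S \<inter> parcs G `` S)"
    using r by (intro mult_le_mono1)
  ultimately have le: "r * card (parcs G `` S0) + 1 \<le> card S0"
    by linarith
  \<comment> \<open>Only the independent set is trimmed to the exact size; \<open>T\<close> remains
    the full neighbourhood of \<open>S0\<close>, so its size does not change.\<close>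
  obtain S' where S': "S' \<subseteq> S0" "card S' = r * card (parcs G `` S0) + 1"
    using obtain_subset_with_card_n[OF le] by metis
  obtain v where "v \<in> S0"
    using le by (cases "S0 = {}") auto
  then have "parcs G `` {v} \<noteq> {}" "parcs G `` {v} \<subseteq> parcs G `` S0"
    using iso S(2) by (auto simp: no_isolated_vertices_def neighborhood_def S0_def)
  then have "parcs G `` S0 \<noteq> {}"
    by blast
  show ?thesis
  proof (rule that)
    show "S' \<subseteq> pverts G" "parcs G `` S0 \<subseteq> pverts G" "parcs G `` S' \<subseteq> parcs G `` S0"
      using S' S(2) by (auto simp: S0_def dest: in_arcsD2)
    show "S' \<inter> parcs G `` S0 = {}"
      using S'(1) \<open>parcs G `` S0 \<inter> S = {}\<close> by (auto simp: S0_def)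
    show "1 \<le> card (parcs G `` S0)"
      using \<open>parcs G `` S0 \<noteq> {}\<close> fin by (simp add: Suc_le_eq card_gt_0_iff)
    show "card S' = r * card (parcs G `` S0) + 1"
      by (fact S'(2))
  qed
qed

section \<open>Spectral radius of subgraphs of the hull\<close>

lemma Image_subset_hull_nbrs:
  assumes G: "pair_graph G" and V: "pverts G = T \<union> S \<union> C" and S: "parcs G `` S \<subseteq> T" "T \<inter> S = {}"
    and v: "v \<in> pverts G"
  shows "parcs G `` {v} \<subseteq> hull_nbrs T S C v"
proof -
  interpret pair_graph G by fact
  have "w \<in> T" if "(v, w) \<in> parcs G" "v \<in> S" for w
    using S that by blast
  moreover have "v \<in> T" if "(v, w) \<in> parcs G" "w \<in> S" for w
    using S arcs_symmetric[OF that(1)] that(2) by blast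
  moreover have "w \<in> T \<union> S \<union> C" "w \<noteq> v" if "(v, w) \<in> parcs G" for w
    using that in_arcsD2 no_loops' V by blast+
  ultimately show ?thesis
    by (auto simp: hull_nbrs_def)
qed

text \<open>The weights \<open>a\<close>, \<open>b\<close>, \<open>c\<close> on \<open>T\<close>,
  \<open>S\<close>, \<open>C\<close> leave one condition per part. \<open>eq_S\<close> and
  \<open>eq_C\<close> settle two of them with equality in the hull, so only the row of
  \<open>T\<close> has to be compared; passing to a subgraph only lowers the sums.\<close>

lemma
  fixes a b c \<mu> :: real
  assumes G: "pair_graph G" and V: "pverts G = T \<union> S \<union> C" "pverts G \<noteq> {}"
    and disj: "T \<inter> S = {}" "T \<inter> C = {}" "S \<inter> C = {}"
    and pos: "0 < a" "0 < b" "0 < c"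
    and eq_S: "card T * a = \<mu> * b" and eq_C: "card T * a + (real (card C) - 1) * c = \<mu> * c"
  shows graph_spectral_radius_hull_le:
      "parcs G `` S \<subseteq> T \<Longrightarrow> (real (card T) - 1) * a + card S * b + card C * c \<le> \<mu> * a
        \<Longrightarrow> graph_spectral_radius G \<le> \<mu>"
    and graph_spectral_radius_hull_eq:
      "(\<And>v. v \<in> pverts G \<Longrightarrow> parcs G `` {v} = hull_nbrs T S C v) \<Longrightarrow>
        (real (card T) - 1) * a + card S * b + card C * c = \<mu> * a \<Longrightarrow> graph_spectral_radius G = \<mu>"
    and graph_spectral_radius_hull_eqD:
      "parcs G `` S \<subseteq> T \<Longrightarrow> (real (card T) - 1) * a + card S * b + card C * c = \<mu> * a \<Longrightarrow>
        card T = 1 \<Longrightarrow> graph_spectral_radius G = \<mu> \<Longrightarrow> v \<in> pverts G \<Longrightarrow> parcs G `` {v} = hull_nbrs T S C v"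
proof -
  interpret pair_graph G by fact
  define x where "x v = (if v \<in> T then a else if v \<in> S then b else c)" for v
  have fin: "finite T" "finite S" "finite C"
    using finite_verts by (simp_all add: V)
  have x: "0 < x v" for v
    using pos by (simp add: x_def)
  have x_T: "x v = a" if "v \<in> T" for v
    using that by (simp add: x_def)
  have sum: "sum x (hull_nbrs T S C v) =
    (if v \<in> T then (real (card T) - 1) * a + card S * b + card C * c else \<mu> * x v)"
    if "v \<in> pverts G" for v
    using sum_hull_nbrs[OF fin disj that[unfolded V(1)], of a b c, folded x_def] eq_S eq_C
    by (simp add: x_def)
  have sub: "parcs G `` {v} \<subseteq> hull_nbrs T S C v" and fin_nbrs: "finite (hull_nbrs T S C v)"
    if "v \<in> pverts G" "parcs G `` S \<subseteq> T" for v
    using Image_subset_hull_nbrs[OF G V(1) that(2) disj(1) that(1)] fin by (auto simp: hull_nbrs_def)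
  have sum_le: "(\<Sum>u\<in>parcs G `` {v}. x u) \<le> \<mu> * x v"
    if "v \<in> pverts G" "parcs G `` S \<subseteq> T"
      "(real (card T) - 1) * a + card S * b + card C * c \<le> \<mu> * a" for v
  proof -
    have "(\<Sum>u\<in>parcs G `` {v}. x u) \<le> sum x (hull_nbrs T S C v)"
      using x by (intro sum_mono2 sub fin_nbrs that less_imp_le)
    also have "\<dots> \<le> \<mu> * x v"
      using sum[OF that(1)] that(3) by (simp add: x_def)
    finally show ?thesis .
  qed
  show "graph_spectral_radius G \<le> \<mu>" if "parcs G `` S \<subseteq> T"
    "(real (card T) - 1) * a + card S * b + card C * c \<le> \<mu> * a"
    by (rule graph_spectral_radius_le[OF G V(2) x sum_le[OF _ that]])
  show "graph_spectral_radius G = \<mu>"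
    if "\<And>v. v \<in> pverts G \<Longrightarrow> parcs G `` {v} = hull_nbrs T S C v"
      "(real (card T) - 1) * a + card S * b + card C * c = \<mu> * a"
    by (rule graph_spectral_radius_eqI[where x = x, OF G V(2) x]) (simp add: that sum x_T)
  assume T: "parcs G `` S \<subseteq> T" "card T = 1"
    and eq: "(real (card T) - 1) * a + card S * b + card C * c = \<mu> * a"
    and rho: "graph_spectral_radius G = \<mu>" and v: "v \<in> pverts G"
  obtain t where t: "T = {t}"
    using T(2) by (auto simp: card_1_singleton_iff)
  obtain M where M: "M \<noteq> {}" "M \<subseteq> pverts G"
    and "\<forall>v\<in>M. parcs G `` {v} \<subseteq> M \<and> (\<Sum>u\<in>parcs G `` {v}. x u) = \<mu> * x v"
    using graph_spectral_radius_eqD[where x = x, OF G V(2) x sum_le[OF _ T(1) eq_refl[OF eq]] rho]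
    by blast
  then have closed: "parcs G `` {v} \<subseteq> M" and sum_eq: "(\<Sum>u\<in>parcs G `` {v}. x u) = \<mu> * x v"
    if "v \<in> M" for v
    using that by blast+
  \<comment> \<open>On \<open>M\<close> the sum over the neighbours in \<open>G\<close> already
    equals that over the hull, so a missing neighbour would lose positive weight.\<close>
  have full: "parcs G `` {v} = hull_nbrs T S C v" if "v \<in> M" for v
  proof (rule ccontr)
    assume "parcs G `` {v} \<noteq> hull_nbrs T S C v"
    moreover have v: "v \<in> pverts G"
      using that M(2) by blast
    ultimately obtain w where "w \<in> hull_nbrs T S C v - parcs G `` {v}"
      using sub[OF v T(1)] by blast
    then have "(\<Sum>u\<in>parcs G `` {v}. x u) < sum x (hull_nbrs T S C v)"
      using x by (intro sum_strict_mono2[OF fin_nbrs sub] v T(1)) (auto intro: less_imp_le)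
    also have "\<dots> = \<mu> * x v"
      using sum[OF v] eq by (simp add: x_def)
    finally show False
      using sum_eq[OF that] by simp
  qed
  obtain u where u: "u \<in> M"
    using M(1) by blast
  \<comment> \<open>The single vertex of \<open>T\<close> is a hull neighbour of every other vertex,
    so the closed set \<open>M\<close> contains it and then everything.\<close>
  have "t \<in> M"
  proof (cases "u = t")
    case False
    then have "t \<in> hull_nbrs T S C u"
      by (simp add: hull_nbrs_def t)
    then show ?thesis
      using full[OF u] closed[OF u] by blast
  qed (use u in simp)
  moreover have "pverts G - {t} \<subseteq> hull_nbrs T S C t"
    using disj by (auto simp: hull_nbrs_def t V(1))
  ultimately have "pverts G \<subseteq> M"
    using full[of t] closed[of t] by blast
  then show "parcs G `` {v} = hull_nbrs T S C v"
    using full v by blast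
qed

text \<open>Arbitrary bijections between corresponding parts glue to an isomorphism, since adjacency
  of distinct vertices in the hull depends only on their parts.\<close>

lemma graph_iso_hull:
  assumes G: "pair_graph G" and V: "pverts G = T \<union> S \<union> C"
    and disj: "T \<inter> S = {}" "T \<inter> C = {}" "S \<inter> C = {}"
    and nbrs: "\<And>v. v \<in> pverts G \<Longrightarrow> parcs G `` {v} = hull_nbrs T S C v"
    and H: "pair_graph H" and V': "pverts H = T' \<union> S' \<union> C'"
    and disj': "T' \<inter> S' = {}" "T' \<inter> C' = {}" "S' \<inter> C' = {}"
    and nbrs': "\<And>v. v \<in> pverts H \<Longrightarrow> parcs H `` {v} = hull_nbrs T' S' C' v"
    and card: "card T = card T'" "card S = card S'" "card C = card C'"
  shows "graph_iso G H"
proof -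
  interpret G: pair_graph G by fact
  interpret H: pair_graph H by fact
  have fin: "finite T" "finite S" "finite C" "finite T'" "finite S'" "finite C'"
    using G.finite_verts H.finite_verts by (simp_all add: V V')
  obtain f g k where f: "bij_betw f T T'" and g: "bij_betw g S S'" and k: "bij_betw k C C'"
    using fin card by (metis finite_same_card_bij)
  define h where "h v = (if v \<in> T then f v else if v \<in> S then g v else k v)" for v
  have "bij_betw h T T'" "bij_betw h S S'" "bij_betw h C C'"
    using f g k disj by (subst bij_betw_cong[of _ h]; fastforce simp: h_def)+
  then have bij: "bij_betw h (T \<union> S \<union> C) (T' \<union> S' \<union> C')"
    and img: "h ` T = T'" "h ` S = S'" "h ` C = C'"
    using disj' by (auto simp: bij_betw_imp_surj_on intro!: bij_betw_combine)
  have "parcs H `` {h v} = h ` (parcs G `` {v})" if v: "v \<in> pverts G" for v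
  proof -
    have "h v \<in> pverts H"
      using bij v V V' by (auto simp: bij_betw_def)
    then show ?thesis
      using image_hull_nbrs[of h T S C v] bij v nbrs[OF v] nbrs'[of "h v"] V img
      by (simp add: bij_betw_def)
  qed
  then show ?thesis
    using bij V V' graph_iso_iff[OF G H] by auto
qed

text \<open>An eigenfunction of \<open>H\<close> composed with the bijection is an eigenfunction of
  \<open>G\<close> for the same eigenvalue.\<close>

lemma graph_iso_graph_spectral_radius_le:
  assumes G: "pair_graph G" and H: "pair_graph H" and iso: "graph_iso G H" and ne: "pverts G \<noteq> {}"
  shows "graph_spectral_radius H \<le> graph_spectral_radius G"
proof -
  obtain h where bij: "bij_betw h (pverts G) (pverts H)"
    and nbrs: "\<And>v. v \<in> pverts G \<Longrightarrow> parcs H `` {h v} = h ` (parcs G `` {v})"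
    using iso graph_iso_iff[OF G H] by blast
  interpret pair_graph G by fact
  have ne': "pverts H \<noteq> {}"
    using ne bij by (auto simp: bij_betw_def)
  obtain k :: complex and f where k: "norm k = graph_spectral_radius H"
    and f0: "\<exists>v\<in>pverts H. f v \<noteq> 0"
    and f: "\<forall>v\<in>pverts H. (\<Sum>u\<in>parcs H `` {v}. f u) = k * f v"
    using graph_spectral_radius_eigenfunction[OF H ne'] by blast
  obtain v where v: "v \<in> pverts G" "(f \<circ> h) v \<noteq> 0"
    using f0 bij_betw_imp_surj_on[OF bij] by force
  have "norm k \<le> graph_spectral_radius G"
  proof (rule norm_le_graph_spectral_radius[where f = "f \<circ> h", OF G ne v])
    fix v assume v: "v \<in> pverts G"
    have "inj_on h (parcs G `` {v})"
      using bij by (rule inj_on_subset[OF bij_betw_imp_inj_on]) (auto dest: in_arcsD2)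
    then have "(\<Sum>u\<in>parcs G `` {v}. (f \<circ> h) u) = (\<Sum>u\<in>parcs H `` {h v}. f u)"
      by (simp only: nbrs[OF v] sum.reindex)
    also have "\<dots> = k * (f \<circ> h) v"
      using f v bij by (auto simp: bij_betw_def)
    finally show "(\<Sum>u\<in>parcs G `` {v}. (f \<circ> h) u) = k * (f \<circ> h) v" .
  qed
  then show ?thesis
    by (simp add: k)
qed

lemma graph_iso_graph_spectral_radius_eq:
  assumes G: "pair_graph G" and H: "pair_graph H" and iso: "graph_iso G H" and ne: "pverts G \<noteq> {}"
  shows "graph_spectral_radius G = graph_spectral_radius H"
proof (rule antisym)
  interpret pair_graph G by fact
  have "graph_iso H G"
    using iso wf_digraph digraph_iso_swap unfolding graph_iso_def by blast
  moreover have "pverts H \<noteq> {}"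
    using iso ne graph_iso_iff[OF G H] by (auto simp: bij_betw_def)
  ultimately show "graph_spectral_radius G \<le> graph_spectral_radius H"
    by (intro graph_iso_graph_spectral_radius_le[OF H G])
qed (rule graph_iso_graph_spectral_radius_le[OF assms])

section \<open>Comparison with the extremal graph\<close>

theorem theorem1p5:
  fixes r n :: nat and G :: "'a pair_pre_digraph"
  assumes "r \<ge> 1" and "n \<ge> 2 * r + 15"
    and "pair_graph G" and "card (pverts G) = n"
    and "no_isolated_vertices G"
    and "binding_number G < 1 / real r"
  shows "let H = graph_join (complete_graph 1)
                   (graph_union (complete_graph (n - r - 2)) (edgeless_graph (r + 1)))
         in graph_spectral_radius G \<le> graph_spectral_radius H \<and>
            (graph_spectral_radius G = graph_spectral_radius H \<longleftrightarrow> graph_iso G H)"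
proof -
  interpret pair_graph G by fact
  define m where "m = n - r - 2"
  define H where "H = graph_join (complete_graph 1) (graph_union (complete_graph m) (edgeless_graph (r + 1)))"
  have H: "pair_graph H"
    unfolding H_def by (intro pair_graph_graph_join pair_graph_graph_union
      pair_graph_complete_graph pair_graph_edgeless_graph)
  have m: "real m = real n - real r - 2" "r + 13 \<le> m"
    using assms(2) by (simp_all add: m_def)
  define T' :: "(nat + nat + nat) set" where "T' = {Inl 0}"
  define S' :: "(nat + nat + nat) set" where "S' = (Inr \<circ> Inr) ` {0..<r + 1}"
  define C' :: "(nat + nat + nat) set" where "C' = (Inr \<circ> Inl) ` {0..<m}"
  have V': "pverts H = T' \<union> S' \<union> C'"
    by (auto simp: H_def graph_join_def graph_union_def complete_graph_def edgeless_graph_def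
      T'_def S'_def C'_def Plus_def image_Un image_image)
  have disj': "T' \<inter> S' = {}" "T' \<inter> C' = {}" "S' \<inter> C' = {}"
    by (auto simp: T'_def S'_def C'_def)
  have nbrs': "parcs H `` {v} = hull_nbrs T' S' C' v" if "v \<in> pverts H" for v
    using that unfolding V'
    by (auto simp: H_def graph_join_def graph_union_def complete_graph_def edgeless_graph_def
      T'_def S'_def C'_def hull_nbrs_def image_iff)
  have card': "card T' = 1" "card S' = r + 1" "card C' = m"
    by (simp_all add: T'_def S'_def C'_def card_image inj_on_def)
  obtain l :: real where l: "real m < l" "real m / (l - real m + 1) + (real r + 1) / l = l"
  proof (rule extremal_eigenvalue_exists)
    show "0 < real m" "1 \<le> real r + 1"
      using m(2) by simp_all
  qed
  \<comment> \<open>The equations on the independent set, on the clique and at the centre, in the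
    shape of the hull lemmas with one vertex in \<open>T\<close>; they serve both \<open>H\<close>
    and \<open>G\<close>.\<close>
  have "0 < (1 :: real)" "0 < 1 / l" "0 < 1 / (l - real m + 1)"
    "1 * 1 = l * (1 / l)"
    "1 * 1 + (real m - 1) * (1 / (l - real m + 1)) = l * (1 / (l - real m + 1))"
    using l by (simp_all add: field_simps)
  moreover have "(1 - 1) * 1 + real (r + 1) * (1 / l) + real m * (1 / (l - real m + 1)) = l * 1"
    using l(2) by (simp add: ac_simps)
  ultimately have weights: "0 < (1 :: real)" "0 < 1 / l" "0 < 1 / (l - real m + 1)"
    "1 * 1 = l * (1 / l)"
    "1 * 1 + (real m - 1) * (1 / (l - real m + 1)) = l * (1 / (l - real m + 1))"
    "(1 - 1) * 1 + real (r + 1) * (1 / l) + real m * (1 / (l - real m + 1)) = l * 1"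
    by blast+
  have "pverts H \<noteq> {}"
    by (simp add: V' T'_def)
  have rho_H: "graph_spectral_radius H = l"
    by (rule graph_spectral_radius_hull_eq[OF H V' _ disj' weights(1-3) _ _ nbrs'])
      (use \<open>pverts H \<noteq> {}\<close> weights in \<open>simp_all add: card'\<close>)
  have ne: "pverts G \<noteq> {}"
    using assms(2,4) by auto
  obtain W where W: "W \<noteq> {}" "W \<subseteq> pverts G" "card (parcs G `` W) < 1 / r * card W"
    using binding_number_lessD[OF assms(3) ne assms(6)] by metis
  have "real (r * card (parcs G `` W)) < real (card W)"
    using W(3) assms(1) by (simp add: field_simps)
  then have "r * card (parcs G `` W) < card W"
    by linarith
  from independent_witness[OF assms(3,5,1) W(1,2) this]
  obtain S T where S: "S \<subseteq> pverts G" "card S = r * card T + 1" "S \<inter> T = {}" "parcs G `` S \<subseteq> T"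
    and T: "T \<subseteq> pverts G" "1 \<le> card T"
    by metis
  define C where "C = pverts G - T - S"
  have V: "pverts G = T \<union> S \<union> C" and disj: "T \<inter> S = {}" "T \<inter> C = {}" "S \<inter> C = {}"
    using S T by (auto simp: C_def)
  have "finite T" "finite S" "finite C"
    using finite_verts by (simp_all add: V)
  then have n: "n = card T + (r * card T + 1) + card C"
    using assms(4) disj by (simp add: V card_Un_disjoint Int_Un_distrib2 S(2))
  have main: "graph_spectral_radius G \<le> l \<and> (graph_spectral_radius G = l \<longrightarrow> graph_iso G H)"
  proof (cases "card T = 1")
    case True
    then have card: "card S = r + 1" "card C = m"
      using S(2) n by (simp_all add: m_def)
    have "graph_spectral_radius G \<le> l"
      by (rule graph_spectral_radius_hull_le[OF assms(3) V ne disj weights(1-3) _ _ S(4)])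
        (use weights in \<open>simp_all add: card True\<close>)
    moreover have "graph_iso G H" if "graph_spectral_radius G = l"
    proof (rule graph_iso_hull[OF assms(3) V disj _ H V' disj' nbrs'])
      show "parcs G `` {v} = hull_nbrs T S C v" if "v \<in> pverts G" for v
        by (rule graph_spectral_radius_hull_eqD[OF assms(3) V ne disj weights(1-3) _ _ S(4)])
          (use weights that \<open>graph_spectral_radius G = l\<close> in \<open>simp_all add: card True\<close>)
    qed (simp_all add: card card' True)
    ultimately show ?thesis
      by blast
  next
    case False
    then have t: "2 \<le> card T"
      using T(2) by simp
    \<comment> \<open>Here q = m + 1 - card C, so t / q is the clique weight that solves the clique
      equation with eigenvalue m.\<close>
    define q where "q = (real r + 1) * (real (card T) - 1) + 1"
    have q: "0 < q"
      using t by (simp add: q_def add_nonneg_pos)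
    have C: "real (card C) = real m + 1 - q"
      unfolding m(1) using n by (simp add: q_def algebra_simps)
    have "(r + 1) * card T + 1 \<le> n"
      using n by simp
    from quotient_row_bound[OF assms(1) t assms(2) this, folded m(1) q_def]
    have bound: "real (card T) - 1 + (real r * real (card T) + 1) * (real (card T) / m)
        + (real m + 1 - q) * (real (card T) / q) \<le> m" .
    have "graph_spectral_radius G \<le> m"
    proof (rule graph_spectral_radius_hull_le[where a = 1
          and b = "real (card T) / real m" and c = "real (card T) / q", OF assms(3) V ne disj _ _ _ _ _ S(4)])
      show "0 < (1 :: real)" "0 < real (card T) / real m" "0 < real (card T) / q"
        "real (card T) * 1 = real m * (real (card T) / real m)"
        using m(2) q T(2) by simp_all
      show "real (card T) * 1 + (real (card C) - 1) * (real (card T) / q) = real m * (real (card T) / q)"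
        using q by (simp add: C field_simps)
      show "(real (card T) - 1) * 1 + real (card S) * (real (card T) / real m)
          + real (card C) * (real (card T) / q) \<le> real m * 1"
        using bound by (simp add: S(2) C add.commute[of _ 1])
    qed
    \<comment> \<open>Since m < l, equality cannot occur in this case.\<close>
    then show ?thesis
      using l(1) by simp
  qed
  show ?thesis
    unfolding m_def[symmetric] H_def[symmetric] Let_def rho_H
    using main graph_iso_graph_spectral_radius_eq[OF assms(3) H _ ne] rho_H by auto
qed

end
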